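(* For a primitive, aperiodic substitution $\sigma:A\to A^+$ on a finite alphabet $A$ with at least two letters, having a fixed point $u\in A^{\mathbb{Z}_+}$, let $$B=\{(a,b)\in A\times A: a\ne b,\ \sigma^k(a)=\sigma^k(b)\text{ for some }k\in\mathbb{N}\}$$ and $$p=\begin{cases}\displaystyle\max_{(a,b)\in B}\min\{k\in\mathbb{N}:\sigma^k(a)=\sigma^k(b)\}+1 & \text{if }B\ne\emptyset,\\ 1&\text{otherwise.}\end{cases}$$ Then the constant $p$ is computable; that is, there is an algorithm which, given such a substitution $\sigma$, outputs $p$.
   Context: $\mathbb{N}=\{1,2,\dots\}$, $\mathbb{Z}_+=\{0\}\cup\mathbb{N}$. $A^+$ is the set of nonempty finite words over $A$. A substitution $\sigma:A\to A^+$ is extended to words and sequences by concatenation. It is primitive if there is $k\in\mathbb{N}$ such that every letter $a$ occurs in $\sigma^k(b)$ for all $a,b\in A$. It is assumed that $\sigma$ has a fixed point $u=\sigma(u)\in A^{\mathbb{Z}_+}$, and $\sigma$ is aperiodic if $T^iu\ne u$ for all $i\in\mathbb{N}$, $T$ being the left shift on $A^{\mathbb{Z}_+}$. *)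

theory Defs
  imports "HOL-Library.Stream" "HOL-Library.Nat_Bijection"
begin

section \<open>Substitutions\<close>

definition substitution_on :: "'a set \<Rightarrow> ('a \<Rightarrow> 'a list) \<Rightarrow> bool" where
  "substitution_on A \<sigma> \<longleftrightarrow> (\<forall>a\<in>A. \<sigma> a \<noteq> [] \<and> set (\<sigma> a) \<subseteq> A)"

definition subst_word :: "('a \<Rightarrow> 'a list) \<Rightarrow> 'a list \<Rightarrow> 'a list" where
  "subst_word \<sigma> w = concat (map \<sigma> w)"

text \<open>The infinite concatenation of the words \<open>\<sigma> (u !! 0)\<close>, \<open>\<sigma> (u !! 1)\<close>, \<dots>; \<open>flat\<close> is only
  meaningful when all of these words are nonempty.\<close>

definition subst_seq :: "('a \<Rightarrow> 'a list) \<Rightarrow> 'a stream \<Rightarrow> 'a stream" where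
  "subst_seq \<sigma> u = flat (smap \<sigma> u)"

definition subst_pow :: "('a \<Rightarrow> 'a list) \<Rightarrow> nat \<Rightarrow> 'a \<Rightarrow> 'a list" where
  "subst_pow \<sigma> k a = (subst_word \<sigma> ^^ k) [a]"

definition primitive_subst :: "'a set \<Rightarrow> ('a \<Rightarrow> 'a list) \<Rightarrow> bool" where
  "primitive_subst A \<sigma> \<longleftrightarrow> (\<exists>k\<ge>1. \<forall>a\<in>A. \<forall>b\<in>A. a \<in> set (subst_pow \<sigma> k b))"

definition fixed_point :: "'a set \<Rightarrow> ('a \<Rightarrow> 'a list) \<Rightarrow> 'a stream \<Rightarrow> bool" where
  "fixed_point A \<sigma> u \<longleftrightarrow> u \<in> streams A \<and> subst_seq \<sigma> u = u"

text \<open>\<open>sdrop i\<close> is the \<open>i\<close>-th power of the left shift.\<close>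

definition aperiodic_seq :: "'a stream \<Rightarrow> bool" where
  "aperiodic_seq u \<longleftrightarrow> (\<forall>i\<ge>1. sdrop i u \<noteq> u)"

definition merging_pairs :: "'a set \<Rightarrow> ('a \<Rightarrow> 'a list) \<Rightarrow> ('a \<times> 'a) set" where
  "merging_pairs A \<sigma> =
     {(a, b) \<in> A \<times> A. a \<noteq> b \<and> (\<exists>k\<ge>1. subst_pow \<sigma> k a = subst_pow \<sigma> k b)}"

definition merging_const :: "'a set \<Rightarrow> ('a \<Rightarrow> 'a list) \<Rightarrow> nat" where
  "merging_const A \<sigma> =
     (if merging_pairs A \<sigma> \<noteq> {}
      then Max ((\<lambda>(a, b). LEAST k. k \<ge> 1 \<and> subst_pow \<sigma> k a = subst_pow \<sigma> k b)
                ` merging_pairs A \<sigma>) + 1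
      else 1)"

section \<open>Algorithms\<close>

text \<open>An algorithm is a description of a partial recursive function in the sense of Kleene.
  \<open>computes f xs y\<close> means that the evaluation of \<open>f\<close> on the arguments \<open>xs\<close> halts with
  output \<open>y\<close>. Primitive recursion and minimisation act on the first argument; a term applied
  to a list of the wrong length may fail to have a value.\<close>

datatype recf =
    Zero
  | Succ
  | Proj nat
  | Comp recf "recf list"
  | PrimRec recf recf
  | Mu recf

inductive computes :: "recf \<Rightarrow> nat list \<Rightarrow> nat \<Rightarrow> bool" where
  zero: "computes Zero xs 0"
| succ: "computes Succ [x] (Suc x)"
| proj: "i < length xs \<Longrightarrow> computes (Proj i) xs (xs ! i)"
| comp: "list_all2 (\<lambda>g y. computes g xs y) gs ys \<Longrightarrow> computes f ys z
    \<Longrightarrow> computes (Comp f gs) xs z"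
| rec_0: "computes f xs y \<Longrightarrow> computes (PrimRec f g) (0 # xs) y"
| rec_Suc: "computes (PrimRec f g) (n # xs) y \<Longrightarrow> computes g (n # y # xs) z
    \<Longrightarrow> computes (PrimRec f g) (Suc n # xs) z"
| mu: "computes f (n # xs) 0 \<Longrightarrow> (\<forall>i<n. \<exists>y>0. computes f (i # xs) y)
    \<Longrightarrow> computes (Mu f) xs n"

inductive_cases computes_ZeroE: "computes Zero xs z"
inductive_cases computes_SuccE: "computes Succ xs z"
inductive_cases computes_ProjE: "computes (Proj i) xs z"
inductive_cases computes_CompE: "computes (Comp f gs) xs z"
inductive_cases computes_PrimRec_0E: "computes (PrimRec f g) (0 # xs) z"
inductive_cases computes_PrimRec_SucE: "computes (PrimRec f g) (Suc n # xs) z"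
inductive_cases computes_MuE: "computes (Mu f) xs z"

lemma computes_functional:
  "computes f xs y \<Longrightarrow> computes f xs z \<Longrightarrow> y = z"
proof (induction arbitrary: z rule: computes.induct)
  case (zero xs)
  then show ?case by (rule computes_ZeroE) simp
next
  case (succ x)
  then show ?case by (rule computes_SuccE) simp
next
  case (proj i xs)
  from proj.prems show ?case by (rule computes_ProjE) simp
next
  case (comp xs gs ys f v)
  from comp.prems obtain ys' where ys': "list_all2 (\<lambda>g y. computes g xs y) gs ys'"
    and z: "computes f ys' z"
    by (rule computes_CompE) blast
  have "ys' = ys"
  proof (rule nth_equalityI)
    show "length ys' = length ys"
      using comp.IH(1) ys' by (simp add: list_all2_conv_all_nth)
    show "ys' ! i = ys ! i" if "i < length ys'" for i
      using comp.IH(1) ys' that unfolding list_all2_conv_all_nth by metis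
  qed
  with z comp.IH(2) show ?case by blast
next
  case (rec_0 f xs y g)
  from rec_0.prems have "computes f xs z" by (rule computes_PrimRec_0E)
  then show ?case by (rule rec_0.IH)
next
  case (rec_Suc f g n xs y v)
  from rec_Suc.prems obtain y' where "computes (PrimRec f g) (n # xs) y'"
    and "computes g (n # y' # xs) z"
    by (rule computes_PrimRec_SucE)
  with rec_Suc.IH show ?case by blast
next
  case (mu f n xs)
  from mu.prems have z: "computes f (z # xs) 0" "\<forall>i<z. \<exists>y>0. computes f (i # xs) y"
    by (rule computes_MuE, blast)+
  show ?case
  proof (cases n z rule: linorder_cases)
    case less
    then obtain y where "y > 0" "computes f (n # xs) y" using z(2) by blast
    with mu.IH(1) show ?thesis by blast
  next
    case greater
    then obtain y where "y > 0" "\<forall>w. computes f (z # xs) w \<longrightarrow> y = w" using mu.IH(2) by blast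
    with z(1) show ?thesis by blast
  qed
qed

section \<open>Substitutions as inputs of algorithms\<close>

text \<open>An input of an algorithm is a finite object, so the letters are taken to be natural numbers.
  A substitution on a finite alphabet \<open>A\<close> is presented by the table of all pairs
  \<open>(a, \<sigma> a)\<close> with \<open>a \<in> A\<close>, in increasing order of \<open>a\<close>; the values of \<open>\<sigma>\<close>
  outside \<open>A\<close> do not enter.\<close>

definition subst_code :: "nat set \<Rightarrow> (nat \<Rightarrow> nat list) \<Rightarrow> nat" where
  "subst_code A \<sigma> =
     list_encode (map (\<lambda>a. prod_encode (a, list_encode (\<sigma> a))) (sorted_list_of_set A))"

end

theory Submission imports Defs begin

text \<open>The words \<open>\<sigma>\<^sup>k(a)\<close> and \<open>\<sigma>\<^sup>k(b)\<close> can be compared for every given \<open>k\<close>. What has to be known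
  is when to stop searching for a \<open>k\<close> that merges \<open>a\<close> and \<open>b\<close>. The answer is \<open>card A\<close>: whatever
  merges at all has merged after \<open>card A\<close> steps (\<open>merging_within_card_steps\<close>). If \<open>\<sigma>\<close> is
  injective on words, distinct words never merge. Otherwise \<open>\<sigma>\<close> factors as \<open>g \<circ> h\<close> through words
  over a smaller alphabet \<open>C\<close>, a form of the defect theorem
  (\<open>noninjective_factors_through_smaller_alphabet\<close>). Then \<open>h \<circ> \<sigma>\<^sup>k = (h \<circ> g)\<^sup>k \<circ> h\<close> and
  \<open>\<sigma>\<^bsup>k+1\<^esup> = g \<circ> (h \<circ> g)\<^sup>k \<circ> h\<close>, so merging under \<open>\<sigma>\<close> lags at most one step behind merging under
  the substitution \<open>h \<circ> g\<close> on \<open>C\<close>, and induction on the alphabet applies.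

  It follows that for any \<open>N \<ge> card A\<close> the constant is \<open>1 + j\<close>, where \<open>j\<close> is least such that every
  pair of letters merged at time \<open>N\<close> is already merged at time \<open>j\<close>
  (\<open>merging_const_eq_Least\<close>). Without merging pairs this gives \<open>j = 0\<close>, as it should. The code of \<open>\<sigma>\<close> is at least the number of its rows, so the code itself serves
  as \<open>N\<close>. What remains is to see that the condition on \<open>j\<close> is a computable function of the code,
  so that minimisation finds \<open>j\<close>. All operations on words and tables used for this are
  obtained by folding a computable function over a coded list (\<open>computable_fold\<close>).\<close>

section \<open>Nonerasing morphisms\<close>

lemma subst_word_simps [simp]:
  "subst_word f [] = []"
  "subst_word f (a # w) = f a @ subst_word f w"
  "subst_word f (v @ w) = subst_word f v @ subst_word f w"
  by (simp_all add: subst_word_def)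

text \<open>Domain and codomain have separate alphabets because the factors of a substitution lead from
  one alphabet to another.\<close>

definition nonerasing :: "'a set \<Rightarrow> 'a set \<Rightarrow> ('a \<Rightarrow> 'a list) \<Rightarrow> bool" where
  "nonerasing A B f \<longleftrightarrow> (\<forall>a\<in>A. f a \<in> lists B \<and> f a \<noteq> [])"

lemma nonerasing_substitution_on: "nonerasing A A \<sigma> \<longleftrightarrow> substitution_on A \<sigma>"
  by (auto simp: nonerasing_def substitution_on_def)

lemma subst_word_in_lists: "nonerasing A B f \<Longrightarrow> w \<in> lists A \<Longrightarrow> subst_word f w \<in> lists B"
  by (induction w) (auto simp: nonerasing_def)

lemma subst_word_eq_Nil_iff:
  "nonerasing A B f \<Longrightarrow> w \<in> lists A \<Longrightarrow> subst_word f w = [] \<longleftrightarrow> w = []"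
  by (cases w) (auto simp: nonerasing_def)

lemma subst_word_comp: "subst_word (\<lambda>a. subst_word g (f a)) w = subst_word g (subst_word f w)"
  by (induction w) simp_all

lemma subst_word_cong:
  "w \<in> lists A \<Longrightarrow> (\<And>a. a \<in> A \<Longrightarrow> f a = g a) \<Longrightarrow> subst_word f w = subst_word g w"
  by (induction w) auto

lemma nonerasing_comp:
  assumes "nonerasing A B f" "nonerasing B C g"
  shows "nonerasing A C (\<lambda>a. subst_word g (f a))"
  using assms subst_word_in_lists[OF assms(2)] subst_word_eq_Nil_iff[OF assms(2)]
  unfolding nonerasing_def by blast

section \<open>Factoring noninjective morphisms\<close>

text \<open>Cancelling the common first letters of two words with the same image ends at two distinct
  letters: neither word runs out before the other, because no nonempty word has empty
  image.\<close>

lemma noninjective_distinct_first_letters: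
  assumes f: "nonerasing A B f" and "x \<in> lists A" "y \<in> lists A" "x \<noteq> y"
    and "subst_word f x = subst_word f y"
  shows "\<exists>a\<in>A. \<exists>b\<in>A. \<exists>x'\<in>lists A. \<exists>y'\<in>lists A.
    a \<noteq> b \<and> f a @ subst_word f x' = f b @ subst_word f y'"
  using assms(2-)
proof (induction x arbitrary: y)
  case Nil
  then show ?case using subst_word_eq_Nil_iff[OF f] by (metis subst_word_simps(1))
next
  case (Cons a x)
  then obtain b y' where y: "y = b # y'"
    using f by (cases y) (auto simp: nonerasing_def)
  show ?case
  proof (cases "a = b")
    case True
    then show ?thesis using Cons.prems y by (intro Cons.IH[of y']) simp_all
  next
    case False
    then show ?thesis using Cons.hyps Cons.prems y
      by (intro bexI[of _ a] bexI[of _ b] bexI[of _ x] bexI[of _ y']) simp_all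
  qed
qed

text \<open>Take distinct letters \<open>a\<close> and \<open>b\<close> that begin two words with the same image. Then one of
  \<open>f a\<close>, \<open>f b\<close> is a prefix of the other, say \<open>f b = f a @ w\<close>. If \<open>w\<close> is empty,
  the letter \<open>b\<close> can be replaced by \<open>a\<close>. Otherwise \<open>f\<close> is the map \<open>b \<mapsto> ab\<close> followed by
  \<open>f' = f(b := w)\<close>, which is again noninjective but has a smaller total length of images, so
  induction on that length applies to \<open>f'\<close>.\<close>

lemma noninjective_factors_through_smaller_alphabet:
  assumes "finite A" "nonerasing A B f" "\<not> inj_on (subst_word f) (lists A)"
  shows "\<exists>C h g. C \<subset> A \<and> nonerasing A C h \<and> nonerasing C B g \<and> (\<forall>a\<in>A. f a = subst_word g (h a))"
  using assms(2,3)
proof (induction "\<Sum>a\<in>A. length (f a)" arbitrary: f rule: less_induct)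
  case less
  note f = less.prems(1)
  obtain x y where "x \<in> lists A" "y \<in> lists A" "x \<noteq> y" "subst_word f x = subst_word f y"
    using less.prems(2) by (auto simp: inj_on_def)
  from noninjective_distinct_first_letters[OF f this] obtain a b x y
    where ab: "a \<in> A" "b \<in> A" "a \<noteq> b" and xy: "x \<in> lists A" "y \<in> lists A"
      and eq: "f a @ subst_word f x = f b @ subst_word f y"
      and le: "length (f a) \<le> length (f b)"
    by (metis nle_le)
  from eq le obtain w where "f a @ w = f b" and w2: "subst_word f x = w @ subst_word f y"
    by (auto simp: append_eq_append_conv2)
  note w = this(1)[symmetric] w2
  show ?case
  proof (cases "w = []")
    case True
    have "nonerasing A (A - {b}) ((\<lambda>c. [c])(b := [a]))" "nonerasing (A - {b}) B f"
      using f ab by (auto simp: nonerasing_def)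
    moreover have "\<forall>c\<in>A. f c = subst_word f (((\<lambda>c. [c])(b := [a])) c)"
      using True w by simp
    moreover have "A - {b} \<subset> A" using ab by auto
    ultimately show ?thesis by blast
  next
    case False
    define f' where "f' = f(b := w)"
    define \<phi> where "\<phi> = (\<lambda>c. [c])(b := [a, b])"
    have f': "nonerasing A B f'"
      using f w ab False by (fastforce simp: nonerasing_def f'_def)
    have \<phi>: "nonerasing A A \<phi>"
      using ab by (auto simp: nonerasing_def \<phi>_def)
    have f'_\<phi>: "subst_word f' (\<phi> c) = f c" for c
      using w ab by (auto simp: \<phi>_def f'_def)
    then have f'_\<phi>_word: "subst_word f' (subst_word \<phi> v) = subst_word f v" for v
      by (simp flip: subst_word_comp)
    \<comment> \<open>Two distinct words merged by \<open>f'\<close>: no word in the range of \<open>\<phi>\<close> begins with \<open>b\<close>.\<close>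
    have "subst_word f' (subst_word \<phi> x) = subst_word f' (b # subst_word \<phi> y)"
      using w by (simp add: f'_\<phi>_word) (simp add: f'_def)
    moreover have "subst_word \<phi> x \<noteq> b # subst_word \<phi> y"
      using ab by (cases x) (auto simp: \<phi>_def)
    moreover have "subst_word \<phi> x \<in> lists A" "b # subst_word \<phi> y \<in> lists A"
      using xy ab subst_word_in_lists[OF \<phi>] by auto
    ultimately have ninj: "\<not> inj_on (subst_word f') (lists A)"
      by (meson inj_onD)
    have "length w < length (f b)"
      using w f ab by (auto simp: nonerasing_def)
    then have "(\<Sum>c\<in>A. length (f' c)) < (\<Sum>c\<in>A. length (f c))"
      using assms(1) ab by (intro sum_strict_mono_ex1) (auto simp: f'_def)
    from less.hyps[OF this f' ninj] obtain C h g where C: "C \<subset> A" "nonerasing A C h" "nonerasing C B g"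
      and g: "\<forall>c\<in>A. f' c = subst_word g (h c)" by blast
    have "f c = subst_word g (subst_word h (\<phi> c))" if "c \<in> A" for c
    proof -
      have "\<phi> c \<in> lists A" using \<phi> that by (simp add: nonerasing_def)
      then have "subst_word f' (\<phi> c) = subst_word (\<lambda>d. subst_word g (h d)) (\<phi> c)"
        using g by (intro subst_word_cong) auto
      then show ?thesis by (simp add: f'_\<phi> subst_word_comp)
    qed
    then show ?thesis using C nonerasing_comp[OF \<phi> C(2)] by blast
  qed
qed

section \<open>A bound on the merging time\<close>

text \<open>In the noninjective case the merging time under \<open>\<sigma> = g \<circ> h\<close> is compared with the one
  under \<open>\<tau> = h \<circ> g\<close>, which acts on a proper subset \<open>C\<close> of \<open>A\<close>. The step
  \<open>card C + 1 \<le> card A\<close> pays for the one extra application of \<open>\<sigma>\<close>.\<close>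

lemma merging_within_card_steps:
  assumes "finite A" "nonerasing A A \<sigma>" "x \<in> lists A" "y \<in> lists A"
    and "(subst_word \<sigma> ^^ k) x = (subst_word \<sigma> ^^ k) y"
  shows "(subst_word \<sigma> ^^ card A) x = (subst_word \<sigma> ^^ card A) y"
  using assms
proof (induction A arbitrary: \<sigma> x y rule: finite_psubset_induct)
  case (psubset A)
  note \<sigma> = psubset.prems(1)
  let ?S = "subst_word \<sigma>"
  have closed: "(?S ^^ m) w \<in> lists A" if "w \<in> lists A" for w m
    using that by (induction m) (auto simp: subst_word_in_lists[OF \<sigma>, simplified])
  show ?case
  proof (cases "inj_on ?S (lists A)")
    case True
    have "(?S ^^ m) x = (?S ^^ m) y \<Longrightarrow> x = y" for m
      using True closed psubset.prems(2,3) by (induction m) (auto dest!: inj_onD)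
    then show ?thesis using psubset.prems(4) by auto
  next
    case False
    from noninjective_factors_through_smaller_alphabet[OF psubset.hyps(1) \<sigma> False]
    obtain C h g where C: "C \<subset> A" and h: "nonerasing A C h" and g: "nonerasing C A g"
      and gh: "\<forall>a\<in>A. \<sigma> a = subst_word g (h a)" by blast
    define \<tau> where "\<tau> = (\<lambda>c. subst_word h (g c))"
    let ?T = "subst_word \<tau>" and ?G = "subst_word g" and ?H = "subst_word h"
    have \<tau>: "nonerasing C C \<tau>" unfolding \<tau>_def by (rule nonerasing_comp[OF g h])
    have S: "?S w = ?G (?H w)" if "w \<in> lists A" for w
      using subst_word_cong[OF that, of \<sigma> "\<lambda>a. ?G (h a)"] gh by (simp add: subst_word_comp)
    have T: "?T w = ?H (?G w)" for w
      by (simp add: \<tau>_def subst_word_comp)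
    have HS: "?H ((?S ^^ m) w) = (?T ^^ m) (?H w)" if "w \<in> lists A" for m w
    proof (induction m)
      case (Suc m)
      then show ?case using S[OF closed[OF that, of m]] by (simp add: T)
    qed simp
    have SG: "(?S ^^ Suc m) w = ?G ((?T ^^ m) (?H w))" if "w \<in> lists A" for m w
      using S[OF closed[OF that, of m]] HS[OF that] by simp
    have "(?T ^^ card C) (?H x) = (?T ^^ card C) (?H y)"
      using psubset.prems HS by (intro psubset.IH[OF C \<tau>] subst_word_in_lists[OF h]) metis+
    then have "(?S ^^ Suc (card C)) x = (?S ^^ Suc (card C)) y"
      using psubset.prems(2,3) by (simp only: SG)
    moreover have "card A = (card A - Suc (card C)) + Suc (card C)"
      using psubset_card_mono[OF psubset.hyps(1) C] by simp
    ultimately show ?thesis by (metis funpow_add o_apply)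
  qed
qed

lemma subst_pow_eq_mono:
  assumes "subst_pow \<sigma> k a = subst_pow \<sigma> k b" "k \<le> m"
  shows "subst_pow \<sigma> m a = subst_pow \<sigma> m b"
  using assms by (metis subst_pow_def funpow_add le_add_diff_inverse2 o_apply)

text \<open>Since merged letters stay merged, a number \<open>j\<close> satisfies the condition below exactly when it
  is at least the merging time of every pair in \<^term>\<open>merging_pairs A \<sigma>\<close>. This makes the least
  such \<open>j\<close> the maximum in the definition of \<^const>\<open>merging_const\<close>, or \<open>0\<close> if there are no pairs.\<close>

lemma merging_const_eq_Least:
  assumes "finite A" "substitution_on A \<sigma>" "card A \<le> N"
  shows "merging_const A \<sigma> = Suc (LEAST j. \<forall>a\<in>A. \<forall>b\<in>A.
    subst_pow \<sigma> N a = subst_pow \<sigma> N b \<longrightarrow> subst_pow \<sigma> j a = subst_pow \<sigma> j b)"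
    (is "_ = Suc (LEAST j. ?P j)")
proof -
  have merged: "subst_pow \<sigma> N a = subst_pow \<sigma> N b"
    if "a \<in> A" "b \<in> A" "subst_pow \<sigma> k a = subst_pow \<sigma> k b" for a b k
  proof (rule subst_pow_eq_mono)
    show "subst_pow \<sigma> (card A) a = subst_pow \<sigma> (card A) b"
      using merging_within_card_steps[of A \<sigma> "[a]" "[b]" k] assms(1,2) that
      by (simp add: nonerasing_substitution_on subst_pow_def)
  qed fact
  let ?B = "merging_pairs A \<sigma>"
  let ?l = "\<lambda>(a, b). LEAST k. k \<ge> 1 \<and> subst_pow \<sigma> k a = subst_pow \<sigma> k b"
  have P_iff: "?P j \<longleftrightarrow> (\<forall>(a, b)\<in>?B. subst_pow \<sigma> j a = subst_pow \<sigma> j b)" for j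
  proof
    assume "?P j"
    then show "\<forall>(a, b)\<in>?B. subst_pow \<sigma> j a = subst_pow \<sigma> j b"
      using merged unfolding merging_pairs_def by blast
  next
    assume *: "\<forall>(a, b)\<in>?B. subst_pow \<sigma> j a = subst_pow \<sigma> j b"
    show "?P j"
    proof (intro ballI impI)
      fix a b assume ab: "a \<in> A" "b \<in> A" "subst_pow \<sigma> N a = subst_pow \<sigma> N b"
      \<comment> \<open>The exponent of a merging pair has to be positive, which \<open>Suc N\<close> visibly is.\<close>
      have "subst_pow \<sigma> (Suc N) a = subst_pow \<sigma> (Suc N) b"
        using ab(3) by (rule subst_pow_eq_mono) simp
      then have "\<exists>k\<ge>1. subst_pow \<sigma> k a = subst_pow \<sigma> k b"
        by (intro exI[of _ "Suc N"]) simp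
      then have "a = b \<or> (a, b) \<in> ?B"
        using ab(1,2) by (simp add: merging_pairs_def)
      then show "subst_pow \<sigma> j a = subst_pow \<sigma> j b" using * by auto
    qed
  qed
  show ?thesis
  proof (cases "?B = {}")
    case True
    then have "(LEAST j. ?P j) = 0" unfolding P_iff by simp
    then show ?thesis using True by (simp add: merging_const_def)
  next
    case False
    have fin: "finite ?B"
      using assms(1) by (auto intro: finite_subset[of _ "A \<times> A"] simp: merging_pairs_def)
    have l: "subst_pow \<sigma> (?l (a, b)) a = subst_pow \<sigma> (?l (a, b)) b" if "(a, b) \<in> ?B" for a b
    proof -
      have "\<exists>k. k \<ge> 1 \<and> subst_pow \<sigma> k a = subst_pow \<sigma> k b"
        using that by (auto simp: merging_pairs_def)
      from LeastI_ex[OF this] show ?thesis by simp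
    qed
    have "(LEAST j. ?P j) = Max (?l ` ?B)"
    proof (rule Least_equality)
      show "?P (Max (?l ` ?B))"
        unfolding P_iff
      proof (clarify)
        fix a b assume ab: "(a, b) \<in> ?B"
        then have "?l (a, b) \<le> Max (?l ` ?B)" using fin by (intro Max_ge) auto
        with l[OF ab] show "subst_pow \<sigma> (Max (?l ` ?B)) a = subst_pow \<sigma> (Max (?l ` ?B)) b"
          by (rule subst_pow_eq_mono)
      qed
    next
      fix j assume "?P j"
      then have eq: "subst_pow \<sigma> j a = subst_pow \<sigma> j b" if "(a, b) \<in> ?B" for a b
        using that unfolding P_iff by blast
      have "?l (a, b) \<le> j" if ab: "(a, b) \<in> ?B" for a b
      proof -
        have "a \<noteq> b" using ab by (simp add: merging_pairs_def)
        \<comment> \<open>Distinct letters are not merged at time \<open>0\<close>, so \<open>j\<close> itself competes in the minimum.\<close>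
        then have "j \<ge> 1"
          using eq[OF ab] by (cases j) (auto simp: subst_pow_def)
        then show ?thesis using eq[OF ab] by (auto intro: Least_le)
      qed
      then show "Max (?l ` ?B) \<le> j"
        using fin False by (auto simp: Max_le_iff)
    qed
    then show ?thesis using False by (simp add: merging_const_def)
  qed
qed

section \<open>Computable functions\<close>

text \<open>Totality on all argument lists of length \<open>n\<close> makes computability closed under composition
  with no side conditions on halting. Arguments are named by position, as \<open>xs ! i\<close>, so that
  the closure rules apply to function bodies by resolution.\<close>

definition computable :: "nat \<Rightarrow> (nat list \<Rightarrow> nat) \<Rightarrow> bool" where
  "computable n F \<longleftrightarrow> (\<exists>r. \<forall>xs. length xs = n \<longrightarrow> computes r xs (F xs))"

lemma computable_cong:
  "computable n F \<Longrightarrow> (\<And>xs. length xs = n \<Longrightarrow> F xs = G xs) \<Longrightarrow> computable n G"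
  unfolding computable_def by metis

lemma computable_zero: "computable n (\<lambda>xs. 0)"
  unfolding computable_def using zero by blast

lemma computable_nth: "i < n \<Longrightarrow> computable n (\<lambda>xs. xs ! i)"
  unfolding computable_def using proj by blast

lemma computable_nth_drop:
  assumes "i + d < n"
  shows "computable n (\<lambda>xs. drop d xs ! i)"
  using assms by (intro computable_cong[OF computable_nth[of "d + i"]]) auto

lemma computable_nth_drop_drop: "i + (d + e) < n \<Longrightarrow> computable n (\<lambda>xs. drop d (drop e xs) ! i)"
  using computable_nth_drop by simp

lemma computable_comp:
  assumes "computable (length Gs) F" "\<And>G. G \<in> set Gs \<Longrightarrow> computable n G"
  shows "computable n (\<lambda>xs. F (map (\<lambda>G. G xs) Gs))"
proof -
  obtain r where r: "\<And>xs. length xs = length Gs \<Longrightarrow> computes r xs (F xs)"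
    using assms(1) by (auto simp: computable_def)
  obtain \<rho> where \<rho>: "\<And>G xs. G \<in> set Gs \<Longrightarrow> length xs = n \<Longrightarrow> computes (\<rho> G) xs (G xs)"
    using assms(2) unfolding computable_def by metis
  have "computes (Comp r (map \<rho> Gs)) xs (F (map (\<lambda>G. G xs) Gs))" if "length xs = n" for xs
    using \<rho> that by (intro comp[OF _ r]) (auto simp: list_all2_conv_all_nth)
  then show ?thesis unfolding computable_def by blast
qed

lemma computable_comp1:
  assumes "computable 1 (\<lambda>xs. f (xs ! 0))" "computable n G"
  shows "computable n (\<lambda>xs. f (G xs))"
  using computable_comp[of "[G]" "\<lambda>xs. f (xs ! 0)" n] assms by simp

lemma computable_comp2:
  assumes "computable 2 (\<lambda>xs. f (xs ! 0) (xs ! 1))" "computable n G" "computable n H"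
  shows "computable n (\<lambda>xs. f (G xs) (H xs))"
  using computable_comp[of "[G, H]" "\<lambda>xs. f (xs ! 0) (xs ! 1)" n] assms
  by (auto simp: numeral_2_eq_2)

lemma computable_comp3:
  assumes "computable 3 (\<lambda>xs. f (xs ! 0) (xs ! 1) (xs ! 2))"
    and "computable n G" "computable n H" "computable n K"
  shows "computable n (\<lambda>xs. f (G xs) (H xs) (K xs))"
  using computable_comp[of "[G, H, K]" "\<lambda>xs. f (xs ! 0) (xs ! 1) (xs ! 2)" n] assms
  by (auto simp: numeral_3_eq_3 numeral_2_eq_2)

text \<open>Primitive recursion and folding add new entries in front of the arguments. This rule adapts a
  function of such a longer list: \<open>d\<close> entries of the current list are replaced by computed
  ones and the parameters behind them are passed on.\<close>

lemma computable_comp_append_drop: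
  assumes F: "computable (length Gs + n) F" and Gs: "\<And>G. G \<in> set Gs \<Longrightarrow> computable (n + d) G"
  shows "computable (n + d) (\<lambda>xs. F (map (\<lambda>G. G xs) Gs @ drop d xs))"
proof -
  let ?Gs = "Gs @ map (\<lambda>i xs. xs ! (d + i)) [0..<n]"
  have "computable (n + d) (\<lambda>xs. F (map (\<lambda>G. G xs) ?Gs))"
    using F Gs by (intro computable_comp) (auto intro: computable_nth)
  then show ?thesis
  proof (rule computable_cong)
    fix xs :: "nat list" assume "length xs = n + d"
    then have "map (\<lambda>i. xs ! (d + i)) [0..<n] = drop d xs"
      by (intro nth_equalityI) auto
    then show "F (map (\<lambda>G. G xs) ?Gs) = F (map (\<lambda>G. G xs) Gs @ drop d xs)"
      by (simp add: o_def)
  qed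
qed

lemma computable_drop:
  assumes "computable n F"
  shows "computable (n + d) (\<lambda>xs. F (drop d xs))"
  using computable_comp_append_drop[of "[]" n F d] assms by simp

lemma computable_rec_nat:
  assumes a: "computable n a" and h: "computable (n + 2) (\<lambda>ys. h (ys ! 0) (ys ! 1) (drop 2 ys))"
    and b: "computable n b"
  shows "computable n (\<lambda>xs. rec_nat (a xs) (\<lambda>m r. h m r xs) (b xs))"
proof -
  obtain ra where ra: "\<And>xs. length xs = n \<Longrightarrow> computes ra xs (a xs)"
    using a by (auto simp: computable_def)
  obtain rh where rh: "\<And>ys. length ys = n + 2 \<Longrightarrow> computes rh ys (h (ys ! 0) (ys ! 1) (drop 2 ys))"
    using h by (auto simp: computable_def)
  have "computes (PrimRec ra rh) (m # xs) (rec_nat (a xs) (\<lambda>m r. h m r xs) m)"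
    if "length xs = n" for m xs
  proof (induction m)
    case 0
    then show ?case using ra[OF that] by (simp add: rec_0)
  next
    case (Suc m)
    let ?r = "rec_nat (a xs) (\<lambda>m r. h m r xs) m"
    have "computes rh (m # ?r # xs) (h m ?r xs)"
      using rh[of "m # ?r # xs"] that by simp
    with Suc show ?case by (simp add: rec_Suc)
  qed
  then have "computable (length [b] + n) (\<lambda>ys. rec_nat (a (tl ys)) (\<lambda>m r. h m r (tl ys)) (hd ys))"
    unfolding computable_def by (intro exI[of _ "PrimRec ra rh"]) (auto simp: length_Suc_conv)
  from computable_comp_append_drop[OF this, of 0] b show ?thesis by simp
qed

text \<open>The existence assumption ranges over all argument lists, since otherwise the search could
  run forever on some of them.\<close>

lemma computable_Least:
  assumes F: "computable (Suc n) (\<lambda>ys. f (hd ys) (tl ys))"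
    and ex: "\<And>xs. length xs = n \<Longrightarrow> \<exists>j. f j xs = 0"
  shows "computable n (\<lambda>xs. LEAST j. f j xs = 0)"
proof -
  obtain r where r: "\<And>ys. length ys = Suc n \<Longrightarrow> computes r ys (f (hd ys) (tl ys))"
    using F by (auto simp: computable_def)
  have r': "computes r (j # xs) (f j xs)" if "length xs = n" for j xs
    using r[of "j # xs"] that by simp
  have "computes (Mu r) xs (LEAST j. f j xs = 0)" if xs: "length xs = n" for xs
  proof (rule mu)
    show "computes r ((LEAST j. f j xs = 0) # xs) 0"
      using r'[OF xs] LeastI_ex[OF ex[OF xs]] by metis
    show "\<forall>i<LEAST j. f j xs = 0. \<exists>y>0. computes r (i # xs) y"
      using r'[OF xs] not_less_Least by blast
  qed
  then show ?thesis unfolding computable_def by blast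
qed

lemma computable_Suc:
  assumes "computable n G"
  shows "computable n (\<lambda>xs. Suc (G xs))"
proof (rule computable_comp1[OF _ assms])
  have "computes Succ xs (Suc (xs ! 0))" if "length xs = 1" for xs
    using that by (auto simp: length_Suc_conv succ)
  then show "computable 1 (\<lambda>xs. Suc (xs ! 0))" unfolding computable_def by blast
qed

lemma computable_add:
  assumes "computable n G" "computable n H"
  shows "computable n (\<lambda>xs. G xs + H xs)"
proof -
  have eq: "rec_nat x (\<lambda>_. Suc) y = x + y" for x y :: nat by (induction y) simp_all
  have "computable n (\<lambda>xs. rec_nat (G xs) (\<lambda>_. Suc) (H xs))"
    using assms by (intro computable_rec_nat computable_Suc computable_nth) simp_all
  then show ?thesis by (simp only: eq)
qed

lemma computable_diff_1:
  assumes "computable n G"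
  shows "computable n (\<lambda>xs. G xs - 1)"
proof -
  have eq: "rec_nat 0 (\<lambda>m _. m) y = y - 1" for y :: nat by (cases y) simp_all
  have "computable n (\<lambda>xs. rec_nat 0 (\<lambda>m _. m) (G xs))"
    using assms by (intro computable_rec_nat computable_zero computable_nth) simp_all
  then show ?thesis by (simp only: eq)
qed

lemma computable_diff:
  assumes "computable n G" "computable n H"
  shows "computable n (\<lambda>xs. G xs - H xs)"
proof -
  have eq: "rec_nat x (\<lambda>_ r. r - 1) y = x - y" for x y :: nat by (induction y) simp_all
  have "computable n (\<lambda>xs. rec_nat (G xs) (\<lambda>_ r. r - 1) (H xs))"
    using assms by (intro computable_rec_nat computable_diff_1 computable_nth) simp_all
  then show ?thesis by (simp only: eq)
qed

text \<open>The branches are selected by recursion on the distance of \<open>G xs\<close> and \<open>H xs\<close>, which is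
  zero exactly for equal values.\<close>

lemma computable_if_eq:
  assumes "computable n G" "computable n H" "computable n K" "computable n L"
  shows "computable n (\<lambda>xs. if G xs = H xs then K xs else L xs)"
proof -
  have eq: "rec_nat c (\<lambda>_ _. d) ((a - b) + (b - a)) = (if a = b then c else d)" for a b c d :: nat
    by (cases "(a - b) + (b - a)") auto
  have "computable n (\<lambda>xs. rec_nat (K xs) (\<lambda>_ _. L xs) ((G xs - H xs) + (H xs - G xs)))"
    using assms by (intro computable_rec_nat computable_drop computable_add computable_diff)
  then show ?thesis by (simp only: eq)
qed

lemma computable_triangle:
  assumes "computable n G"
  shows "computable n (\<lambda>xs. triangle (G xs))"
proof -
  have eq: "rec_nat 0 (\<lambda>m r. r + Suc m) y = triangle y" for y by (induction y) simp_all
  have "computable n (\<lambda>xs. rec_nat 0 (\<lambda>m r. r + Suc m) (G xs))"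
    using assms
    by (intro computable_rec_nat computable_add computable_Suc computable_zero computable_nth) simp_all
  then show ?thesis by (simp only: eq)
qed

lemma computable_prod_encode:
  assumes "computable n G" "computable n H"
  shows "computable n (\<lambda>xs. prod_encode (G xs, H xs))"
  unfolding prod_encode_def prod.case
  using assms by (intro computable_add computable_triangle)

section \<open>Decoding pairs and folding over coded lists\<close>

lemma triangle_mono: "m \<le> n \<Longrightarrow> triangle m \<le> triangle n"
  by (rule lift_Suc_mono_le[of triangle]) simp_all

text \<open>The code of \<open>(a, b)\<close> lies at position \<open>a\<close> of the diagonal \<open>a + b\<close>, which starts at
  \<^term>\<open>triangle (a + b)\<close>. Searching for the diagonal and subtracting its start recovers both
  components. The search condition is \<open>prod_encode (a, b) < triangle (Suc s)\<close>, written as an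
  equation with \<open>0\<close> to suit minimisation.\<close>

lemma Least_triangle_prod_encode:
  "(LEAST s. Suc (prod_encode (a, b)) - triangle (Suc s) = 0) = a + b"
proof (rule Least_equality)
  show "Suc (prod_encode (a, b)) - triangle (Suc (a + b)) = 0"
    by (simp add: prod_encode_def)
next
  fix s assume s: "Suc (prod_encode (a, b)) - triangle (Suc s) = 0"
  show "a + b \<le> s"
  proof (rule ccontr)
    assume "\<not> a + b \<le> s"
    then have "triangle (Suc s) \<le> triangle (a + b)" by (intro triangle_mono) simp
    with s show False by (simp add: prod_encode_def)
  qed
qed

lemma computable_diagonal: "computable 1 (\<lambda>xs. LEAST s. Suc (xs ! 0) - triangle (Suc s) = 0)"
proof (rule computable_Least)
  have "computable 2 (\<lambda>ys. Suc (ys ! 1) - triangle (Suc (ys ! 0)))"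
    by (intro computable_diff computable_Suc computable_triangle computable_nth) simp_all
  then show "computable (Suc 1) (\<lambda>ys. Suc (tl ys ! 0) - triangle (Suc (hd ys)))"
    unfolding Suc_1 by (rule computable_cong) (auto simp: numeral_2_eq_2 length_Suc_conv)
next
  fix xs :: "nat list"
  obtain a b where "xs ! 0 = prod_encode (a, b)" by (metis prod_decode_inverse surj_pair)
  then show "\<exists>s. Suc (xs ! 0) - triangle (Suc s) = 0"
    by (intro exI[of _ "a + b"]) (simp add: prod_encode_def)
qed

lemma fst_prod_decode:
  "fst (prod_decode z) = z - triangle (LEAST s. Suc z - triangle (Suc s) = 0)"
proof -
  obtain a b where "z = prod_encode (a, b)" by (metis prod_decode_inverse surj_pair)
  then show ?thesis
    by (simp only: Least_triangle_prod_encode prod_encode_inverse) (simp add: prod_encode_def)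
qed

lemma snd_prod_decode:
  "snd (prod_decode z) = (LEAST s. Suc z - triangle (Suc s) = 0) - fst (prod_decode z)"
proof -
  obtain a b where "z = prod_encode (a, b)" by (metis prod_decode_inverse surj_pair)
  then show ?thesis
    by (simp only: Least_triangle_prod_encode prod_encode_inverse) simp
qed

lemma computable_fst_prod_decode:
  assumes "computable n G"
  shows "computable n (\<lambda>xs. fst (prod_decode (G xs)))"
  unfolding fst_prod_decode
  by (intro computable_diff computable_triangle computable_comp1[OF computable_diagonal] assms)

lemma computable_snd_prod_decode:
  assumes "computable n G"
  shows "computable n (\<lambda>xs. snd (prod_decode (G xs)))"
  by (subst snd_prod_decode)
    (intro computable_diff computable_fst_prod_decode computable_comp1[OF computable_diagonal] assms)

lemma length_le_list_encode: "length ws \<le> list_encode ws"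
proof (induction ws)
  case (Cons w ws)
  then show ?case using le_prod_encode_2[of "list_encode ws" w] by simp
qed simp

text \<open>One step of a loop with state \<open>(code of the remaining list, accumulator)\<close>. As
  \<open>list_encode (x # xs) = Suc (prod_encode (x, list_encode xs))\<close>, subtracting one from a nonzero
  list code gives the code of head and tail. The empty list is a fixed point, so the loop may be
  run for too long.\<close>

definition fold_step :: "(nat \<Rightarrow> nat \<Rightarrow> nat) \<Rightarrow> nat \<Rightarrow> nat" where
  "fold_step h z = (let ws = fst (prod_decode z); e = prod_decode (ws - 1) in
     if ws = 0 then z else prod_encode (snd e, h (fst e) (snd (prod_decode z))))"

lemma fold_step_Nil: "fold_step h (prod_encode (list_encode [], s)) = prod_encode (list_encode [], s)"
  by (simp add: fold_step_def)

lemma fold_step_Cons: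
  "fold_step h (prod_encode (list_encode (w # ws), s)) = prod_encode (list_encode ws, h w s)"
  by (simp add: fold_step_def)

lemma fold_step_iterate:
  assumes "length ws \<le> k"
  shows "(fold_step h ^^ k) (prod_encode (list_encode ws, s)) =
    prod_encode (list_encode [], fold h ws s)"
  using assms
proof (induction k arbitrary: ws s)
  case (Suc k)
  then show ?case
    by (cases ws) (simp_all add: funpow_Suc_right fold_step_Nil fold_step_Cons
        del: funpow.simps list_encode.simps)
qed simp

text \<open>Enough steps for a coded list are given by its code, by \<open>length_le_list_encode\<close>, which spares
  computing its length.\<close>

lemma computable_fold:
  assumes h: "computable (n + 2) (\<lambda>ys. h (ys ! 0) (ys ! 1) (drop 2 ys))"
    and W: "computable n W" and a: "computable n a"
  shows "computable n (\<lambda>xs. fold (\<lambda>e s. h e s xs) (list_decode (W xs)) (a xs))"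
proof -
  let ?z = "\<lambda>xs. prod_encode (W xs, a xs)"
  have h': "computable (n + 2) (\<lambda>ys. h (G ys) (H ys) (drop 2 ys))"
    if "computable (n + 2) G" "computable (n + 2) H" for G H
    using computable_comp_append_drop[of "[G, H]" n "\<lambda>ys. h (ys ! 0) (ys ! 1) (drop 2 ys)" 2] h that
    by auto
  have "computable (n + 2) (\<lambda>ys. fold_step (\<lambda>e s. h e s (drop 2 ys)) (ys ! 1))"
    unfolding fold_step_def Let_def
    by (intro h' computable_if_eq computable_prod_encode computable_fst_prod_decode
        computable_snd_prod_decode computable_diff_1 computable_nth computable_zero) simp_all
  then have "computable n (\<lambda>xs. snd (prod_decode
      (rec_nat (?z xs) (\<lambda>_. fold_step (\<lambda>e s. h e s xs)) (W xs))))"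
    using computable_rec_nat[of n ?z "\<lambda>_ z xs. fold_step (\<lambda>e s. h e s xs) z" W]
    by (intro computable_snd_prod_decode) (simp add: W a computable_prod_encode)
  moreover have "rec_nat z (\<lambda>_. g) k = (g ^^ k) z" for z k and g :: "nat \<Rightarrow> nat"
    by (induction k) auto
  moreover have "length (list_decode w) \<le> w" for w
    using length_le_list_encode[of "list_decode w"] by simp
  then have "(fold_step g ^^ w) (prod_encode (w, s)) = prod_encode (0, fold g (list_decode w) s)"
    for g w s
    using fold_step_iterate[of "list_decode w" w g s] by simp
  ultimately show ?thesis by simp
qed

lemma computable_sum_list:
  assumes h: "computable (n + 2) (\<lambda>ys. f (ys ! 0) (drop 2 ys))" and W: "computable n W"
  shows "computable n (\<lambda>xs. \<Sum>e\<leftarrow>list_decode (W xs). f e xs)"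
proof -
  have eq: "fold (\<lambda>e s. s + g e) ws s = s + sum_list (map g ws)" for g ws and s :: nat
    by (induction ws arbitrary: s) simp_all
  have "computable n (\<lambda>xs. fold (\<lambda>e s. s + f e xs) (list_decode (W xs)) 0)"
    using assms by (intro computable_fold computable_add computable_nth computable_zero) simp_all
  then show ?thesis by (simp only: eq add_0)
qed

lemmas computable_intros =
  computable_zero computable_nth computable_nth_drop computable_nth_drop_drop computable_Suc
  computable_if_eq computable_prod_encode computable_fst_prod_decode computable_snd_prod_decode
  computable_fold computable_sum_list

section \<open>Computing with tabulated substitutions\<close>

definition rev_append_code :: "nat \<Rightarrow> nat \<Rightarrow> nat" where
  "rev_append_code v w = fold (\<lambda>x w. Suc (prod_encode (x, w))) (list_decode v) w"

lemma rev_append_code: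
  "rev_append_code v w = list_encode (rev (list_decode v) @ list_decode w)"
proof -
  have "fold (\<lambda>x w. Suc (prod_encode (x, w))) xs (list_encode ys) = list_encode (rev xs @ ys)"
    for xs ys
  proof (induction xs arbitrary: ys)
    case (Cons x xs)
    then show ?case using Cons.IH[of "x # ys"] by simp
  qed simp
  from this[of "list_decode v" "list_decode w"] show ?thesis by (simp add: rev_append_code_def)
qed

lemma computable_rev_append_code: "computable 2 (\<lambda>xs. rev_append_code (xs ! 0) (xs ! 1))"
  unfolding rev_append_code_def by (intro computable_intros) simp_all

definition table_lookup :: "nat \<Rightarrow> nat \<Rightarrow> nat" where
  "table_lookup t x = fold (\<lambda>e y. if fst (prod_decode e) = x then snd (prod_decode e) else y)
     (list_decode t) 0"

lemma table_lookup_subst_code: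
  assumes "finite A" "x \<in> A"
  shows "table_lookup (subst_code A \<sigma>) x = list_encode (\<sigma> x)"
proof -
  let ?row = "\<lambda>a. prod_encode (a, list_encode (\<sigma> a))"
  have "fold (\<lambda>e y. if fst (prod_decode e) = x then snd (prod_decode e) else y) (map ?row ws) y =
      (if x \<in> set ws then list_encode (\<sigma> x) else y)" for ws y
    by (induction ws arbitrary: y) auto
  then show ?thesis using assms by (simp add: table_lookup_def subst_code_def)
qed

lemma computable_table_lookup: "computable 2 (\<lambda>xs. table_lookup (xs ! 0) (xs ! 1))"
  unfolding table_lookup_def by (intro computable_intros) simp_all

text \<open>Every number is read as a table, so that the programs below are total. Outside the table the
  value is the empty word, hence this map may be erasing.\<close>

definition table_subst :: "nat \<Rightarrow> nat \<Rightarrow> nat list" where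
  "table_subst t x = list_decode (table_lookup t x)"

text \<open>Pushing the images of the letters onto the front of an accumulator produces the image of the
  word backwards, and reversing it once more puts it in order.\<close>

lemma list_encode_subst_word:
  "rev_append_code (fold (\<lambda>x. rev_append_code (table_lookup t x)) (list_decode w) 0) 0 =
   list_encode (subst_word (table_subst t) (list_decode w))"
proof -
  have "fold (\<lambda>x. rev_append_code (table_lookup t x)) xs v =
      list_encode (rev (subst_word (table_subst t) xs) @ list_decode v)" for xs v
    by (induction xs arbitrary: v) (simp_all add: rev_append_code table_subst_def)
  then show ?thesis by (simp add: rev_append_code)
qed

lemma computable_subst_word:
  "computable 2 (\<lambda>xs. list_encode (subst_word (table_subst (xs ! 0)) (list_decode (xs ! 1))))"
  unfolding list_encode_subst_word[symmetric]
  by (intro computable_intros computable_comp2[OF computable_rev_append_code]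
      computable_comp2[OF computable_table_lookup]) simp_all

lemma list_encode_subst_pow:
  "list_encode (subst_pow \<sigma> k a) =
   rec_nat (Suc (prod_encode (a, 0))) (\<lambda>_ w. list_encode (subst_word \<sigma> (list_decode w))) k"
  by (induction k) (simp_all add: subst_pow_def, metis list_encode_inverse)

lemma computable_subst_pow:
  "computable 3 (\<lambda>xs. list_encode (subst_pow (table_subst (xs ! 0)) (xs ! 1) (xs ! 2)))"
  unfolding list_encode_subst_pow
  by (intro computable_rec_nat computable_intros computable_comp2[OF computable_subst_word]) simp_all

text \<open>The number of pairs of rows whose letters are merged at time \<open>t\<close> but not at time \<open>j\<close>. The
  table code \<open>t\<close> also plays the part of the late time \<open>N\<close>. This makes \<open>j = t\<close> a zero for every
  number \<open>t\<close>, code of a substitution or not, so the search for a zero always ends.\<close>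

definition unmerged_count :: "nat \<Rightarrow> nat \<Rightarrow> nat" where
  "unmerged_count t j = (\<Sum>e\<leftarrow>list_decode t. \<Sum>e'\<leftarrow>list_decode t.
     let w = (\<lambda>k e. list_encode (subst_pow (table_subst t) k (fst (prod_decode e)))) in
     if w t e = w t e' then if w j e = w j e' then 0 else Suc 0 else 0)"

lemma computable_unmerged_count: "computable 2 (\<lambda>xs. unmerged_count (xs ! 0) (xs ! 1))"
  unfolding unmerged_count_def Let_def
  by (intro computable_intros computable_comp3[OF computable_subst_pow]) simp_all

lemma unmerged_count_self: "unmerged_count t t = 0"
  unfolding unmerged_count_def Let_def by auto

lemma computable_Least_unmerged_count:
  "computable 1 (\<lambda>xs. Suc (LEAST j. unmerged_count (xs ! 0) j = 0))"
proof (intro computable_Suc computable_Least)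
  show "computable (Suc 1) (\<lambda>ys. unmerged_count (tl ys ! 0) (hd ys))"
    by (rule computable_cong[OF computable_comp2[OF computable_unmerged_count
            computable_nth[of 1] computable_nth[of 0]]]) (auto simp: length_Suc_conv)
qed (use unmerged_count_self in blast)

text \<open>The table agrees with \<open>\<sigma>\<close> only on \<open>A\<close>, so the induction has to carry along that the words
  stay over \<open>A\<close>.\<close>

lemma subst_pow_table_subst:
  assumes "finite A" "substitution_on A \<sigma>" "a \<in> A"
  shows "subst_pow (table_subst (subst_code A \<sigma>)) k a = subst_pow \<sigma> k a \<and> subst_pow \<sigma> k a \<in> lists A"
proof (induction k)
  case 0
  then show ?case using assms by (simp add: subst_pow_def)
next
  case (Suc k)
  then have "subst_word (table_subst (subst_code A \<sigma>)) (subst_pow \<sigma> k a) = subst_word \<sigma> (subst_pow \<sigma> k a)"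
    by (intro subst_word_cong[of _ A]) (simp_all add: table_subst_def table_lookup_subst_code assms)
  moreover have "subst_word \<sigma> (subst_pow \<sigma> k a) \<in> lists A"
    using Suc assms by (intro subst_word_in_lists[of A]) (simp_all add: nonerasing_substitution_on)
  ultimately show ?case using Suc by (simp add: subst_pow_def)
qed

lemma sum_list_map_eq_0_iff: "(\<Sum>x\<leftarrow>xs. f x) = (0 :: nat) \<longleftrightarrow> (\<forall>x\<in>set xs. f x = 0)"
  by (induction xs) simp_all

lemma unmerged_count_eq_0_iff:
  assumes A: "finite A" "substitution_on A \<sigma>" and t: "t = subst_code A \<sigma>"
  shows "unmerged_count t j = 0 \<longleftrightarrow> (\<forall>a\<in>A. \<forall>b\<in>A.
    subst_pow \<sigma> t a = subst_pow \<sigma> t b \<longrightarrow> subst_pow \<sigma> j a = subst_pow \<sigma> j b)"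
proof -
  have "list_decode t = map (\<lambda>a. prod_encode (a, list_encode (\<sigma> a))) (sorted_list_of_set A)"
    by (simp add: t subst_code_def)
  then show ?thesis
    using subst_pow_table_subst[OF A] A(1)
    by (auto simp: unmerged_count_def Let_def sum_list_map_eq_0_iff list_encode_eq
        simp del: sum_list_eq_0_iff simp flip: t)
qed

lemma card_le_subst_code: "card A \<le> subst_code A \<sigma>"
  using length_le_list_encode[of "map (\<lambda>a. prod_encode (a, list_encode (\<sigma> a))) (sorted_list_of_set A)"]
  by (simp add: subst_code_def)

theorem proposition4p3:
  "\<exists>f. \<forall>(A :: nat set) (\<sigma> :: nat \<Rightarrow> nat list) (u :: nat stream).
     finite A \<longrightarrow> card A \<ge> 2 \<longrightarrow> substitution_on A \<sigma> \<longrightarrow> primitive_subst A \<sigma> \<longrightarrow>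
     fixed_point A \<sigma> u \<longrightarrow> aperiodic_seq u \<longrightarrow>
     computes f [subst_code A \<sigma>] (merging_const A \<sigma>)"
proof -
  obtain f where f: "\<And>xs. length xs = 1 \<Longrightarrow> computes f xs (Suc (LEAST j. unmerged_count (xs ! 0) j = 0))"
    using computable_Least_unmerged_count by (auto simp: computable_def)
  have "computes f [subst_code A \<sigma>] (merging_const A \<sigma>)"
    if "finite A" "substitution_on A \<sigma>" for A \<sigma>
    using f[of "[subst_code A \<sigma>]"] merging_const_eq_Least[OF that card_le_subst_code] that
    by (simp add: unmerged_count_eq_0_iff)
  then show ?thesis by blast
qed

end
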